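(* For each $n$, let $C_n=[-1/2,1/2]^n$, let $\mathbb{T}=\mathbb{T}_n$ be a packing torus of $2C_n$, and let $P=P_n\subseteq\mathbb{T}$ be an $S_n$-packing of $\mathbb{T}$ with $|P|>\operatorname{vol}(\mathbb{T})$, where \[ S_n=\{(x_1,\dots,x_n)\in\mathbb{R}^n:|x_1|+\dots+|x_n|\le2\ln n\}. \] Let $\mathbf{X}\subseteq\mathbb{T}$ be sampled from the Poisson point process on $\mathbb{T}$ with intensity $\rho=\ln|P|-\ln(\operatorname{vol}(\mathbb{T}))$. Then $\mathbb{P}[P\subseteq C_n+\mathbf{X}]\to0$ as $n\to\infty$.
   Context: A lattice $\Lambda\subseteq\mathbb{R}^n$ is the set of integer combinations of $n$ linearly independent vectors; it is a packing lattice of a convex body $L$ if the translates $L+\mathbf{p}$, $\mathbf{p}\in\Lambda$, are pairwise disjoint, and then $\mathbb{T}=\mathbb{R}^n/\Lambda$ is a packing torus of $L$. Volume on $\mathbb{T}$ is Lebesgue measure transferred from a fundamental domain of $\Lambda$; sets of $\mathbb{R}^n$ are identified with their images in $\mathbb{T}$, and $C_n+\mathbf{X}$ denotes the image in $\mathbb{T}$ of $\{\mathbf{c}+\mathbf{x}:\mathbf{c}\in C_n,\mathbf{x}\in\mathbf{X}\}$. A set $P\subseteq\mathbb{T}$ is an $S_n$-packing if for distinct $\mathbf{p},\mathbf{p}'\in P$ the images in $\mathbb{T}$ of $\mathbf{p}+S_n$ and $\mathbf{p}'+S_n$ are disjoint. A random set $\mathbf{X}\subseteq\mathbb{T}$ is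 sampled from the Poisson point process with intensity $\rho$ if for each measurable $S\subseteq\mathbb{T}$, $|\mathbf{X}\cap S|$ is Poisson with mean $\rho\operatorname{vol}(S)$, with counts in disjoint sets independent. *)

theory Defs
  imports "HOL-Probability.Probability" "HOL-Library.Extended_Nat"
begin

text \<open>
  The dimension n varies inside the statement, so the points of n-dimensional space are functions
  on the index set \<open>{..<n}\<close>, extended by \<open>undefined\<close> outside it; this is the carrier of the
  product measure \<open>Rn_measure\<close> (Lebesgue measure on the Borel sets).
\<close>

definition Rn :: "nat \<Rightarrow> (nat \<Rightarrow> real) set" where
  "Rn n = {..<n} \<rightarrow>\<^sub>E UNIV"

definition Rn_measure :: "nat \<Rightarrow> (nat \<Rightarrow> real) measure" where
  "Rn_measure n = PiM {..<n} (\<lambda>_. lborel)"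

definition vadd :: "nat \<Rightarrow> (nat \<Rightarrow> real) \<Rightarrow> (nat \<Rightarrow> real) \<Rightarrow> (nat \<Rightarrow> real)" where
  "vadd n x y = (\<lambda>i\<in>{..<n}. x i + y i)"

definition vdiff :: "nat \<Rightarrow> (nat \<Rightarrow> real) \<Rightarrow> (nat \<Rightarrow> real) \<Rightarrow> (nat \<Rightarrow> real)" where
  "vdiff n x y = (\<lambda>i\<in>{..<n}. x i - y i)"

definition vscale :: "nat \<Rightarrow> real \<Rightarrow> (nat \<Rightarrow> real) \<Rightarrow> (nat \<Rightarrow> real)" where
  "vscale n a x = (\<lambda>i\<in>{..<n}. a * x i)"

definition lin_indep :: "nat \<Rightarrow> (nat \<Rightarrow> nat \<Rightarrow> real) \<Rightarrow> bool" where
  "lin_indep n b \<longleftrightarrow>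
     (\<forall>c :: nat \<Rightarrow> real. (\<forall>j<n. (\<Sum>i<n. c i * b i j) = 0) \<longrightarrow> (\<forall>i<n. c i = 0))"

definition is_lattice :: "nat \<Rightarrow> (nat \<Rightarrow> real) set \<Rightarrow> bool" where
  "is_lattice n L \<longleftrightarrow>
     (\<exists>b. (\<forall>i<n. b i \<in> Rn n) \<and> lin_indep n b \<and>
          L = {(\<lambda>j\<in>{..<n}. \<Sum>i<n. of_int (z i) * b i j) | z :: nat \<Rightarrow> int. True})"

definition packing_lattice :: "nat \<Rightarrow> (nat \<Rightarrow> real) set \<Rightarrow> (nat \<Rightarrow> real) set \<Rightarrow> bool" where
  "packing_lattice n K L \<longleftrightarrow>
     is_lattice n L \<and> pairwise (\<lambda>p q. disjnt (vadd n p ` K) (vadd n q ` K)) L"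


definition lattice_rel :: "nat \<Rightarrow> (nat \<Rightarrow> real) set \<Rightarrow> ((nat \<Rightarrow> real) \<times> (nat \<Rightarrow> real)) set" where
  "lattice_rel n L = {(x, y). x \<in> Rn n \<and> y \<in> Rn n \<and> vdiff n y x \<in> L}"

definition torus :: "nat \<Rightarrow> (nat \<Rightarrow> real) set \<Rightarrow> (nat \<Rightarrow> real) set set" where
  "torus n L = Rn n // lattice_rel n L"

definition to_torus :: "nat \<Rightarrow> (nat \<Rightarrow> real) set \<Rightarrow> (nat \<Rightarrow> real) \<Rightarrow> (nat \<Rightarrow> real) set" where
  "to_torus n L x = lattice_rel n L `` {x}"

text \<open>
  The image in the torus of \<open>A + X\<close>, for A a set of vectors and X a set of torus points;
  \<open>\<Union>X\<close> is the set of all representatives of points of X.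
\<close>

definition torus_sum ::
  "nat \<Rightarrow> (nat \<Rightarrow> real) set \<Rightarrow> (nat \<Rightarrow> real) set \<Rightarrow> (nat \<Rightarrow> real) set set \<Rightarrow> (nat \<Rightarrow> real) set set" where
  "torus_sum n L A X = to_torus n L ` {vadd n a x | a x. a \<in> A \<and> x \<in> \<Union>X}"

definition torus_packing ::
  "nat \<Rightarrow> (nat \<Rightarrow> real) set \<Rightarrow> (nat \<Rightarrow> real) set \<Rightarrow> (nat \<Rightarrow> real) set set \<Rightarrow> bool" where
  "torus_packing n L S P \<longleftrightarrow>
     P \<subseteq> torus n L \<and> pairwise (\<lambda>p q. disjnt (torus_sum n L S {p}) (torus_sum n L S {q})) P"

text \<open>
  A set of torus points is measurable if its preimage in space, which is its union, is Borel.
\<close>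

definition torus_borel :: "nat \<Rightarrow> (nat \<Rightarrow> real) set \<Rightarrow> (nat \<Rightarrow> real) set measure" where
  "torus_borel n L = sigma (torus n L) {A. A \<subseteq> torus n L \<and> \<Union>A \<in> sets (Rn_measure n)}"

definition fundamental_domain :: "nat \<Rightarrow> (nat \<Rightarrow> real) set \<Rightarrow> (nat \<Rightarrow> real) set \<Rightarrow> bool" where
  "fundamental_domain n L D \<longleftrightarrow>
     D \<in> sets (Rn_measure n) \<and> (\<forall>x\<in>Rn n. \<exists>!y. y \<in> D \<and> (x, y) \<in> lattice_rel n L)"

text \<open>
  Every lattice has a fundamental domain, for instance the half-open parallelepiped spanned by a
  basis, and the resulting measure does not depend on the one chosen.
\<close>

definition torus_measure :: "nat \<Rightarrow> (nat \<Rightarrow> real) set \<Rightarrow> (nat \<Rightarrow> real) set measure" where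
  "torus_measure n L =
     distr (restrict_space (Rn_measure n) (SOME D. fundamental_domain n L D))
           (torus_borel n L) (to_torus n L)"

definition torus_vol :: "nat \<Rightarrow> (nat \<Rightarrow> real) set \<Rightarrow> real" where
  "torus_vol n L = measure (torus_measure n L) (torus n L)"


definition num_points :: "'a set \<Rightarrow> enat" where
  "num_points A = (if finite A then enat (card A) else \<infinity>)"

text \<open>
  T is a measure space of finite total volume. The Poisson weights are written out because
  \<open>poisson_pmf\<close> is specified for positive means only, whereas null sets have mean 0
  (and then the count is 0 almost surely, as \<open>0 ^ 0 = 1\<close>). Since the weights sum to 1, a count
  is almost surely finite. Finitely many disjoint sets are covered by taking
  \<open>F i = {}\<close> from some index on.
\<close>

definition poisson_process :: "'w measure \<Rightarrow> 'a measure \<Rightarrow> real \<Rightarrow> ('w \<Rightarrow> 'a set) \<Rightarrow> bool" where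
  "poisson_process M T \<rho> X \<longleftrightarrow>
     prob_space M \<and>
     (\<forall>\<omega>\<in>space M. X \<omega> \<subseteq> space T) \<and>
     (\<forall>S\<in>sets T.
        (\<lambda>\<omega>. num_points (X \<omega> \<inter> S)) \<in> measurable M (count_space UNIV) \<and>
        (\<forall>k. measure M {\<omega>\<in>space M. num_points (X \<omega> \<inter> S) = enat k}
               = (\<rho> * measure T S) ^ k / fact k * exp (- (\<rho> * measure T S)))) \<and>
     (\<forall>F :: nat \<Rightarrow> 'a set. range F \<subseteq> sets T \<longrightarrow> disjoint_family F \<longrightarrow>
        prob_space.indep_vars M (\<lambda>_. count_space UNIV)
          (\<lambda>i \<omega>. num_points (X \<omega> \<inter> F i)) UNIV)"


definition cube :: "nat \<Rightarrow> (nat \<Rightarrow> real) set" where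
  "cube n = {..<n} \<rightarrow>\<^sub>E {- 1/2..1/2}"

definition cross_polytope :: "nat \<Rightarrow> (nat \<Rightarrow> real) set" where
  "cross_polytope n = {x \<in> Rn n. (\<Sum>i<n. \<bar>x i\<bar>) \<le> 2 * ln (real n)}"

end

theory Submission
  imports Defs "HOL-Real_Asymp.Real_Asymp"
begin

text \<open>
  Second moment method. Let \<open>V = vol(T)\<close> and \<open>N = |P|\<close>. The image of \<open>p + C\<close> in the torus has
  volume 1, so a point of \<open>P\<close> is uncovered with probability \<open>exp (- \<rho>) = V / N\<close>, and the expected
  number of uncovered points is \<open>V\<close>, which is at least \<open>2 ^ n\<close> because \<open>2C\<close> packs. Distinct points
  of \<open>P\<close> have \<open>l1\<close>-distance more than \<open>4 ln n\<close>, and two unit cubes at offset \<open>d\<close> meet in volume at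
  most \<open>\<Prod>i. (1 - |d i|)\<^sup>+ \<le> exp (- \<Sum>i. |d i|) \<le> n\<^sup>-\<^sup>4\<close>. Hence two points are both uncovered with
  probability at most \<open>(V / N)\<^sup>2 exp (\<rho> / n\<^sup>4)\<close>. Packing cubes of side \<open>1 / n\<close>, which fit inside
  the cross-polytopes, gives \<open>N \<le> V n\<^sup>n\<close>, so \<open>\<rho> \<le> n ln n\<close>, and Chebyshev bounds the probability that
  every point is covered by \<open>1 / V + exp (n ln n / n\<^sup>4) - 1\<close>. Only void probabilities of the
  Poisson process are used.
\<close>

section \<open>Coordinatewise vectors and translation-invariant volume\<close>

lemma vadd_apply [simp]: "i < n \<Longrightarrow> vadd n x y i = x i + y i"
  and vdiff_apply [simp]: "i < n \<Longrightarrow> vdiff n x y i = x i - y i"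
  and vscale_apply [simp]: "i < n \<Longrightarrow> vscale n a x i = a * x i"
  by (simp_all add: vadd_def vdiff_def vscale_def)

lemma vadd_in_Rn [simp]: "vadd n x y \<in> Rn n"
  and vdiff_in_Rn [simp]: "vdiff n x y \<in> Rn n"
  and vscale_in_Rn [simp]: "vscale n a x \<in> Rn n"
  by (simp_all add: vadd_def vdiff_def vscale_def Rn_def)

lemma Rn_eqI: "x \<in> Rn n \<Longrightarrow> y \<in> Rn n \<Longrightarrow> (\<And>i. i < n \<Longrightarrow> x i = y i) \<Longrightarrow> x = y"
  unfolding Rn_def by (rule PiE_ext) auto

lemma vadd_vdiff_cancel [simp]: "x \<in> Rn n \<Longrightarrow> vadd n (vdiff n x y) y = x"
  and vdiff_vadd_cancel [simp]: "x \<in> Rn n \<Longrightarrow> vdiff n (vadd n x y) y = x"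
  by (auto intro!: Rn_eqI)

lemma space_Rn_measure [simp]: "space (Rn_measure n) = Rn n"
  by (simp add: Rn_measure_def Rn_def space_PiM)

lemma sets_Rn_subset: "A \<in> sets (Rn_measure n) \<Longrightarrow> A \<subseteq> Rn n"
  using sets.sets_into_space by force

lemma measurable_vadd [measurable]: "vadd n v \<in> Rn_measure n \<rightarrow>\<^sub>M Rn_measure n"
  unfolding Rn_measure_def vadd_def by measurable

text \<open>A measure on the finite product is determined by its values on products of sets, so
  invariance is inherited from \<open>lborel\<close> factor by factor.\<close>

lemma distr_vadd: "distr (Rn_measure n) (Rn_measure n) (vadd n v) = Rn_measure n"
proof -
  interpret product_sigma_finite "\<lambda>_. lborel :: real measure" ..
  show "distr (Rn_measure n) (Rn_measure n) (vadd n v) = Rn_measure n"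
    unfolding Rn_measure_def
  proof (rule PiM_eqI)
    fix A :: "nat \<Rightarrow> real set"
    assume A: "\<And>i. i \<in> {..<n} \<Longrightarrow> A i \<in> sets lborel"
    have "vadd n v -` Pi\<^sub>E {..<n} A \<inter> space (Pi\<^sub>M {..<n} (\<lambda>_. lborel))
      = Pi\<^sub>E {..<n} (\<lambda>i. (+) (v i) -` A i)"
      by (auto simp: space_PiM vadd_def PiE_iff)
    moreover have meas: "(+) (v i) -` A i \<in> sets lborel" if "i < n" for i
    proof -
      have "(+) (v i) \<in> borel \<rightarrow>\<^sub>M borel" by measurable
      from measurable_sets[OF this, of "A i"] A that show ?thesis by simp
    qed
    moreover have "emeasure lborel ((+) (v i) -` A i) = emeasure lborel (A i)" if "i < n" for i
    proof -
      have "emeasure lborel (A i) = emeasure (distr lborel borel ((+) (v i))) (A i)"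
        by (simp add: lborel_distr_plus)
      also have "\<dots> = emeasure lborel ((+) (v i) -` A i)"
        using A that by (subst emeasure_distr) auto
      finally show ?thesis by simp
    qed
    ultimately have "emeasure (Pi\<^sub>M {..<n} (\<lambda>_. lborel)) (vadd n v -` Pi\<^sub>E {..<n} A \<inter> space (Pi\<^sub>M {..<n} (\<lambda>_. lborel)))
        = (\<Prod>i\<in>{..<n}. emeasure lborel (A i))"
      by (subst \<open>vadd n v -` Pi\<^sub>E {..<n} A \<inter> _ = _\<close>, subst emeasure_PiM) (auto intro!: prod.cong)
    then show "emeasure (distr (Pi\<^sub>M {..<n} (\<lambda>_. lborel)) (Pi\<^sub>M {..<n} (\<lambda>_. lborel)) (vadd n v)) (Pi\<^sub>E {..<n} A)
        = (\<Prod>i\<in>{..<n}. emeasure lborel (A i))"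
      using A measurable_vadd[of n v]
      by (subst emeasure_distr) (auto simp: Rn_measure_def intro!: sets_PiM_I_finite)
  qed auto
qed

text \<open>Images become preimages under the opposite translation, so measurability and volume of
  translates follow from \<open>measurable_vadd\<close> and \<open>distr_vadd\<close>.\<close>

lemma image_vadd_eq_vimage:
  assumes "A \<subseteq> Rn n"
  shows "vadd n v ` A = vadd n (vscale n (-1) v) -` A \<inter> Rn n"
proof (intro equalityI subsetI)
  fix y assume "y \<in> vadd n v ` A"
  then obtain a where a: "a \<in> A" "y = vadd n v a" by auto
  have "vadd n (vscale n (-1) v) y = a"
    using a assms by (intro Rn_eqI) auto
  then show "y \<in> vadd n (vscale n (-1) v) -` A \<inter> Rn n" using a by auto
next
  fix y assume y: "y \<in> vadd n (vscale n (-1) v) -` A \<inter> Rn n"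
  have "y = vadd n v (vadd n (vscale n (-1) v) y)"
    using y by (intro Rn_eqI) auto
  then show "y \<in> vadd n v ` A" using y by blast
qed

lemma sets_image_vadd [measurable]:
  assumes "A \<in> sets (Rn_measure n)"
  shows "vadd n v ` A \<in> sets (Rn_measure n)"
  using measurable_sets[OF measurable_vadd assms] image_vadd_eq_vimage[OF sets_Rn_subset[OF assms]]
  by simp

lemma emeasure_image_vadd:
  assumes "A \<in> sets (Rn_measure n)"
  shows "emeasure (Rn_measure n) (vadd n v ` A) = emeasure (Rn_measure n) A"
proof -
  have "emeasure (Rn_measure n) A
      = emeasure (distr (Rn_measure n) (Rn_measure n) (vadd n (vscale n (-1) v))) A"
    by (simp add: distr_vadd)
  also have "\<dots> = emeasure (Rn_measure n) (vadd n v ` A)"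
    using assms image_vadd_eq_vimage[OF sets_Rn_subset[OF assms]]
    by (subst emeasure_distr) auto
  finally show ?thesis by simp
qed

section \<open>Cubes, boxes and their volume\<close>

definition box_at :: "nat \<Rightarrow> real \<Rightarrow> (nat \<Rightarrow> real) \<Rightarrow> (nat \<Rightarrow> real) set" where
  "box_at n r x = (\<Pi>\<^sub>E i\<in>{..<n}. {x i - r..x i + r})"

lemma mem_box_at: "y \<in> box_at n r x \<longleftrightarrow> y \<in> Rn n \<and> (\<forall>i<n. \<bar>y i - x i\<bar> \<le> r)"
  by (force simp: box_at_def Rn_def PiE_iff abs_le_iff)

lemma box_at_subset_Rn: "box_at n r x \<subseteq> Rn n"
  by (auto simp: mem_box_at)

lemma sets_PiE_interval [measurable]:
  "(\<Pi>\<^sub>E i\<in>{..<n}. {a i..b i :: real}) \<in> sets (Rn_measure n)"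
  unfolding Rn_measure_def by (rule sets_PiM_I_finite) auto

text \<open>The \<open>max 0\<close> accounts for empty intervals. It lets the bound on overlapping
  cubes go through without a case split on the offset.\<close>

lemma emeasure_PiE_interval:
  "emeasure (Rn_measure n) (\<Pi>\<^sub>E i\<in>{..<n}. {a i..b i :: real}) = ennreal (\<Prod>i<n. max 0 (b i - a i))"
proof -
  interpret product_sigma_finite "\<lambda>_. lborel :: real measure" ..
  have "emeasure (Rn_measure n) (\<Pi>\<^sub>E i\<in>{..<n}. {a i..b i}) = (\<Prod>i<n. ennreal (max 0 (b i - a i)))"
    unfolding Rn_measure_def by (subst emeasure_PiM) (auto intro!: prod.cong simp: max_def ennreal_neg)
  also have "\<dots> = ennreal (\<Prod>i<n. max 0 (b i - a i))"
    by (rule prod_ennreal) simp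
  finally show ?thesis .
qed

lemma sets_box_at [measurable]: "box_at n r x \<in> sets (Rn_measure n)"
  unfolding box_at_def by (rule sets_PiE_interval)

lemma emeasure_box_at: "r \<ge> 0 \<Longrightarrow> emeasure (Rn_measure n) (box_at n r x) = ennreal ((2 * r) ^ n)"
  unfolding box_at_def by (subst emeasure_PiE_interval) simp

section \<open>Lattices as separated countable groups, and congruence modulo them\<close>

text \<open>The packing lattice enters the argument through these properties. A nonempty set closed
  under differences is a group; separation says that \<open>2C\<close> and its translate by a
  nonzero \<open>x\<close> in \<open>L\<close> cannot share the point x/2.\<close>

locale packing_group =
  fixes n :: nat and L :: "(nat \<Rightarrow> real) set"
  assumes L_subset: "L \<subseteq> Rn n"
    and countable_L: "countable L"
    and L_nonempty: "L \<noteq> {}"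
    and vdiff_L: "x \<in> L \<Longrightarrow> y \<in> L \<Longrightarrow> vdiff n x y \<in> L"
    and L_separated: "x \<in> L \<Longrightarrow> (\<And>i. i < n \<Longrightarrow> \<bar>x i\<bar> \<le> 2) \<Longrightarrow> i < n \<Longrightarrow> x i = 0"
begin

lemma vdiff_self_L: "vdiff n x x \<in> L"
proof -
  obtain l where "l \<in> L" using L_nonempty by auto
  moreover have "vdiff n x x = vdiff n l l" by (rule Rn_eqI[of _ n]) auto
  ultimately show ?thesis using vdiff_L by simp
qed

lemma vdiff_swap_L: "vdiff n x y \<in> L \<Longrightarrow> vdiff n y x \<in> L"
proof -
  assume "vdiff n x y \<in> L"
  then have "vdiff n (vdiff n x x) (vdiff n x y) \<in> L" by (rule vdiff_L[OF vdiff_self_L])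
  moreover have "vdiff n (vdiff n x x) (vdiff n x y) = vdiff n y x" by (rule Rn_eqI[of _ n]) auto
  ultimately show ?thesis by simp
qed

lemma vdiff_trans_L: "vdiff n x y \<in> L \<Longrightarrow> vdiff n y z \<in> L \<Longrightarrow> vdiff n x z \<in> L"
proof -
  assume "vdiff n x y \<in> L" "vdiff n y z \<in> L"
  then have "vdiff n (vdiff n x y) (vdiff n z y) \<in> L" using vdiff_L vdiff_swap_L by blast
  moreover have "vdiff n (vdiff n x y) (vdiff n z y) = vdiff n x z" by (rule Rn_eqI[of _ n]) auto
  ultimately show ?thesis by simp
qed

section \<open>Sets that inject into the torus, saturations and fundamental domains\<close>

definition inj_mod :: "(nat \<Rightarrow> real) set \<Rightarrow> bool" where
  "inj_mod A \<longleftrightarrow> (\<forall>x\<in>A. \<forall>y\<in>A. vdiff n x y \<in> L \<longrightarrow> x = y)"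

lemma inj_mod_subset: "inj_mod A \<Longrightarrow> B \<subseteq> A \<Longrightarrow> inj_mod B"
  unfolding inj_mod_def by blast

text \<open>Two points of the box differ by at most 2r in each coordinate, so separation applies up
  to and including r = 1. That extreme case later yields the lower bound \<open>2 ^ n\<close> on the
  volume of the torus.\<close>

lemma inj_mod_box_at:
  assumes "r \<le> 1"
  shows "inj_mod (box_at n r x)"
  unfolding inj_mod_def
proof (intro ballI impI)
  fix y z assume yz: "y \<in> box_at n r x" "z \<in> box_at n r x" and d: "vdiff n y z \<in> L"
  have "\<bar>vdiff n y z i\<bar> \<le> 2" if "i < n" for i
  proof -
    have "\<bar>y i - x i\<bar> \<le> r" "\<bar>z i - x i\<bar> \<le> r" using yz that by (auto simp: mem_box_at)
    then show ?thesis using assms that by simp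
  qed
  then have "vdiff n y z i = 0" if "i < n" for i
    using L_separated[OF d] that by blast
  then show "y = z" using yz by (intro Rn_eqI[of _ n]) (auto simp: mem_box_at)
qed

text \<open>For \<open>A\<close> inside \<open>Rn n\<close> this is the full preimage of the image
  of \<open>A\<close> in the torus. As a union over the countable \<open>L\<close> it is visibly
  Borel.\<close>

definition sat :: "(nat \<Rightarrow> real) set \<Rightarrow> (nat \<Rightarrow> real) set" where
  "sat A = (\<Union>l\<in>L. vadd n l ` A)"

lemma mem_sat:
  assumes "A \<subseteq> Rn n"
  shows "y \<in> sat A \<longleftrightarrow> y \<in> Rn n \<and> (\<exists>a\<in>A. vdiff n y a \<in> L)"
proof
  assume "y \<in> sat A"
  then obtain l a where *: "l \<in> L" "a \<in> A" "y = vadd n l a" by (auto simp: sat_def)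
  then have "vdiff n y a = l" using L_subset by auto
  then have "vdiff n y a \<in> L" using * by simp
  with * show "y \<in> Rn n \<and> (\<exists>a\<in>A. vdiff n y a \<in> L)" by auto
next
  assume "y \<in> Rn n \<and> (\<exists>a\<in>A. vdiff n y a \<in> L)"
  then obtain a where *: "y \<in> Rn n" "a \<in> A" "vdiff n y a \<in> L" by auto
  then have "y = vadd n (vdiff n y a) a" by simp
  with * show "y \<in> sat A" unfolding sat_def by blast
qed

lemma sets_sat [measurable]: "A \<in> sets (Rn_measure n) \<Longrightarrow> sat A \<in> sets (Rn_measure n)"
  unfolding sat_def using countable_L by (intro sets.countable_UN'') auto

text \<open>
  A basis-free construction: cover space by countably many cubes that inject into the torus, and
  from each remove the points equivalent to a point of an earlier one.
\<close>

lemma exists_fundamental_domain: "\<exists>D. fundamental_domain n L D"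
proof -
  \<comment> \<open>Rational centres give countably many cubes that cover space, and radius 1 still
    allows injectivity.\<close>
  define Q where "Q = (\<Pi>\<^sub>E i\<in>{..<n}. \<rat> :: real set)"
  have cQ: "countable Q" unfolding Q_def by (intro countable_PiE) (auto simp: countable_rat)
  have "(\<lambda>i\<in>{..<n}. 0) \<in> Q" by (auto simp: Q_def)
  then have neQ: "Q \<noteq> {}" by blast
  define B where "B k = box_at n 1 (from_nat_into Q k)" for k
  have B: "B k \<in> sets (Rn_measure n)" "B k \<subseteq> Rn n" "inj_mod (B k)" for k
    unfolding B_def using box_at_subset_Rn inj_mod_box_at by auto
  have cover: "\<exists>k. x \<in> B k" if x: "x \<in> Rn n" for x
  proof -
    have "\<exists>q\<in>\<rat>. \<bar>x i - q\<bar> \<le> 1" for i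
    proof -
      obtain q where "q \<in> \<rat>" "x i < q" "q < x i + 1"
        using Rats_dense_in_real[of "x i" "x i + 1"] by auto
      then show ?thesis by (intro bexI[of _ q]) auto
    qed
    then obtain q where q: "q i \<in> \<rat>" "\<bar>x i - q i\<bar> \<le> 1" for i by metis
    then have "restrict q {..<n} \<in> Q" by (auto simp: Q_def)
    then obtain k where "from_nat_into Q k = restrict q {..<n}"
      using from_nat_into_surj[OF cQ] by auto
    then have "x \<in> B k" unfolding B_def mem_box_at using q x by auto
    then show ?thesis ..
  qed
  define D where "D = (\<Union>k. B k - (\<Union>j<k. sat (B j)))"
  have "D \<in> sets (Rn_measure n)"
    unfolding D_def using B by (intro sets.countable_UN) auto
  moreover have "\<exists>!y. y \<in> D \<and> (x, y) \<in> lattice_rel n L" if x: "x \<in> Rn n" for x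
  proof -
    \<comment> \<open>The representative of \<open>x\<close> is sought in the first cube that meets
      the class of \<open>x\<close>.\<close>
    define k where "k = (LEAST k. x \<in> sat (B k))"
    obtain k0 where "x \<in> B k0" using cover x by auto
    then have "x \<in> sat (B k0)" using B x by (auto simp: mem_sat intro!: vdiff_self_L)
    then have k: "x \<in> sat (B k)" unfolding k_def by (rule LeastI)
    have k_least: "x \<notin> sat (B j)" if "j < k" for j
      using not_less_Least that unfolding k_def by blast
    obtain y where y: "y \<in> B k" "vdiff n x y \<in> L" using k B by (auto simp: mem_sat)
    \<comment> \<open>Saturations are unions of classes, so all representatives of a class have the
      same first index \<open>k\<close>.\<close>
    have sat_iff: "z \<in> sat (B j) \<longleftrightarrow> x \<in> sat (B j)" if "vdiff n x z \<in> L" "z \<in> Rn n" for z j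
    proof -
      have "vdiff n z a \<in> L \<longleftrightarrow> vdiff n x a \<in> L" for a
        using that(1) vdiff_trans_L[of z x a] vdiff_trans_L[of x z a] vdiff_swap_L[of x z] by blast
      then show ?thesis using that x B by (simp add: mem_sat)
    qed
    have yRn: "y \<in> Rn n" using y(1) B(2) by blast
    then have "y \<notin> sat (B j)" if "j < k" for j
      using sat_iff[OF y(2)] k_least[OF that] by simp
    then have yD: "y \<in> D" unfolding D_def using y(1) by blast
    \<comment> \<open>Any representative in \<open>D\<close> must come from that same cube
      \<open>B k\<close>, and \<open>B k\<close> contains at most one point of each class.\<close>
    have unique: "z = y" if z: "z \<in> D" "(x, z) \<in> lattice_rel n L" for z
    proof -
      have zx: "z \<in> Rn n" "vdiff n x z \<in> L"
        using z vdiff_swap_L by (auto simp: lattice_rel_def)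
      obtain j where j: "z \<in> B j" "\<And>i. i < j \<Longrightarrow> z \<notin> sat (B i)"
        using z(1) unfolding D_def by blast
      have "z \<in> sat (B j)" using j(1) zx B by (auto simp: mem_sat intro!: vdiff_self_L)
      then have "x \<in> sat (B j)" using sat_iff zx by blast
      then have "\<not> j < k" using k_least by blast
      moreover have "\<not> k < j" using j(2) k sat_iff zx by blast
      ultimately have "z \<in> B k" using j(1) by (cases j k rule: linorder_cases) auto
      moreover have "vdiff n z y \<in> L"
        using vdiff_trans_L[OF vdiff_swap_L] zx(2) y(2) by blast
      ultimately show ?thesis
        using B(3)[of k] y(1) unfolding inj_mod_def by blast
    qed
    have "(x, y) \<in> lattice_rel n L"
      using vdiff_swap_L[OF y(2)] yRn x by (simp add: lattice_rel_def)
    with yD unique show ?thesis by (intro ex1I[of _ y]) blast+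
  qed
  ultimately have "fundamental_domain n L D" unfolding fundamental_domain_def by (intro conjI ballI)
  then show ?thesis by (rule exI[of _ D])
qed

text \<open>Names the choice made inside \<open>torus_measure\<close>, so that facts about it
  transfer after unfolding.\<close>

definition fdom :: "(nat \<Rightarrow> real) set" where
  "fdom = (SOME D. fundamental_domain n L D)"

lemma fundamental_domain_fdom: "fundamental_domain n L fdom"
  unfolding fdom_def using exists_fundamental_domain by (rule someI_ex)

lemma sets_dom [measurable]: "fdom \<in> sets (Rn_measure n)"
  using fundamental_domain_fdom by (simp add: fundamental_domain_def)

lemma fdom_subset_Rn: "fdom \<subseteq> Rn n"
  by (rule sets_Rn_subset[OF sets_dom])

lemma fdom_ex1:
  assumes "x \<in> Rn n"
  shows "\<exists>!y. y \<in> fdom \<and> vdiff n y x \<in> L"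
proof -
  have "(y \<in> fdom \<and> (x, y) \<in> lattice_rel n L) \<longleftrightarrow> (y \<in> fdom \<and> vdiff n y x \<in> L)" for y
    using assms fdom_subset_Rn by (auto simp: lattice_rel_def)
  then show ?thesis
    using fundamental_domain_fdom assms unfolding fundamental_domain_def by (metis (lifting))
qed

text \<open>Split the left set according to the translate l + A containing a point and move each
  piece back by l. The pieces are disjoint because \<open>A\<close> injects modulo \<open>L\<close>;
  after moving they partition \<open>A\<close> because the translates of \<open>fdom\<close> tile
  space.\<close>

lemma emeasure_fdom_Int_sat:
  assumes A: "A \<in> sets (Rn_measure n)" and inj: "inj_mod A"
  shows "emeasure (Rn_measure n) (fdom \<inter> sat A) = emeasure (Rn_measure n) A"
proof -
  let ?M = "Rn_measure n" and ?neg = "vscale n (-1)"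
  note ARn = sets_Rn_subset[OF A]
  have eq: "fdom \<inter> vadd n l ` A = vadd n l ` (vadd n (?neg l) ` fdom \<inter> A)" for l
  proof (intro equalityI subsetI)
    fix y assume y: "y \<in> fdom \<inter> vadd n l ` A"
    then obtain a where a: "a \<in> A" "y = vadd n l a" by auto
    have "a = vadd n (?neg l) y" using a ARn by (intro Rn_eqI[of _ n]) auto
    with a y show "y \<in> vadd n l ` (vadd n (?neg l) ` fdom \<inter> A)" by blast
  next
    fix y assume "y \<in> vadd n l ` (vadd n (?neg l) ` fdom \<inter> A)"
    then obtain d where d: "d \<in> fdom" "vadd n (?neg l) d \<in> A" "y = vadd n l (vadd n (?neg l) d)"
      by auto
    have yd: "y = d" unfolding d(3) using d(1) fdom_subset_Rn
      by (intro Rn_eqI[of _ n]) auto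
    have "y \<in> vadd n l ` A" using d by blast
    then show "y \<in> fdom \<inter> vadd n l ` A" using d(1) yd by simp
  qed
  have m: "vadd n l ` A \<inter> fdom \<in> sets ?M" "vadd n l ` fdom \<inter> A \<in> sets ?M" for l
    using A by auto
  have l_eq: "l = l'" if "l \<in> L" "l' \<in> L" "vadd n l a = vadd n l' a" for l l' a
  proof -
    have "l i = l' i" if "i < n" for i
      using fun_cong[OF \<open>vadd n l a = vadd n l' a\<close>, of i] that by simp
    then show ?thesis using that L_subset by (intro Rn_eqI[of _ n]) auto
  qed
  have "emeasure ?M (fdom \<inter> sat A) = emeasure ?M (\<Union>l\<in>L. fdom \<inter> vadd n l ` A)"
    by (simp add: sat_def)
  also have "\<dots> = (\<integral>\<^sup>+ l. emeasure ?M (fdom \<inter> vadd n l ` A) \<partial>count_space L)"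
  proof (rule emeasure_UN_countable[OF _ countable_L])
    show "disjoint_family_on (\<lambda>l. fdom \<inter> vadd n l ` A) L"
    unfolding disjoint_family_on_def
    proof (intro ballI impI, rule ccontr)
      fix l l' assume ll: "l \<in> L" "l' \<in> L" "l \<noteq> l'"
        and "(fdom \<inter> vadd n l ` A) \<inter> (fdom \<inter> vadd n l' ` A) \<noteq> {}"
      then obtain a a' where a: "a \<in> A" "a' \<in> A" "vadd n l a = vadd n l' a'" by auto
      have "vdiff n a a' = vdiff n l' l"
      proof (rule Rn_eqI[of _ n])
        fix i assume "i < n"
        then show "vdiff n a a' i = vdiff n l' l i" using fun_cong[OF a(3), of i] by simp
      qed auto
      then have "a = a'" using inj a ll vdiff_L unfolding inj_mod_def by simp
      with l_eq a ll show False by blast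
    qed
  qed (use A in auto)
  also have "\<dots> = (\<integral>\<^sup>+ l. emeasure ?M (vadd n (?neg l) ` fdom \<inter> A) \<partial>count_space L)"
    using m by (simp add: eq emeasure_image_vadd)
  also have "\<dots> = emeasure ?M (\<Union>l\<in>L. vadd n (?neg l) ` fdom \<inter> A)"
  proof (rule emeasure_UN_countable[OF _ countable_L, symmetric])
    show "disjoint_family_on (\<lambda>l. vadd n (?neg l) ` fdom \<inter> A) L"
    unfolding disjoint_family_on_def
    proof (intro ballI impI, rule ccontr)
      fix l l' assume ll: "l \<in> L" "l' \<in> L" "l \<noteq> l'"
        and "(vadd n (?neg l) ` fdom \<inter> A) \<inter> (vadd n (?neg l') ` fdom \<inter> A) \<noteq> {}"
      then obtain d d' where d: "d \<in> fdom" "d' \<in> fdom" "vadd n (?neg l) d = vadd n (?neg l') d'"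
        by auto
      have dd: "vdiff n d d' = vdiff n l l'"
      proof (rule Rn_eqI[of _ n])
        fix i assume "i < n"
        then show "vdiff n d d' i = vdiff n l l' i" using fun_cong[OF d(3), of i] by simp
      qed auto
      then have "d = d'"
        using fdom_ex1[of d'] d(1,2) vdiff_L[OF ll(1,2)] vdiff_self_L[of d'] fdom_subset_Rn
        by (metis subsetD)
      then have "l i = l' i" if "i < n" for i
        using fun_cong[OF dd, of i] that by simp
      then show False using ll L_subset Rn_eqI[of l n l'] by auto
    qed
  qed (use A in auto)
  also have "(\<Union>l\<in>L. vadd n (?neg l) ` fdom \<inter> A) = A"
  proof (intro equalityI subsetI)
    fix a assume a: "a \<in> A"
    then obtain d where d: "d \<in> fdom" "vdiff n d a \<in> L" using fdom_ex1[of a] ARn by auto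
    have "a = vadd n (?neg (vdiff n d a)) d"
      using a ARn by (intro Rn_eqI[of _ n]) auto
    with d a show "a \<in> (\<Union>l\<in>L. vadd n (?neg l) ` fdom \<inter> A)" by blast
  qed auto
  finally show ?thesis .
qed

section \<open>The quotient map and the measure on the torus\<close>

lemma to_torus_altdef:
  assumes "x \<in> Rn n"
  shows "to_torus n L x = {y \<in> Rn n. vdiff n y x \<in> L}"
  using assms by (auto simp: to_torus_def lattice_rel_def)

lemma mem_to_torus_self: "x \<in> Rn n \<Longrightarrow> x \<in> to_torus n L x"
  using vdiff_self_L by (simp add: to_torus_altdef)

lemma to_torus_eq_iff:
  assumes "x \<in> Rn n" "y \<in> Rn n"
  shows "to_torus n L x = to_torus n L y \<longleftrightarrow> vdiff n x y \<in> L"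
proof
  assume "to_torus n L x = to_torus n L y"
  then show "vdiff n x y \<in> L" using mem_to_torus_self[OF assms(1)] assms by (auto simp: to_torus_altdef)
next
  assume d: "vdiff n x y \<in> L"
  have "vdiff n z x \<in> L \<longleftrightarrow> vdiff n z y \<in> L" for z
    using vdiff_trans_L[of z x y] vdiff_trans_L[of z y x] vdiff_swap_L[OF d] d by blast
  then show "to_torus n L x = to_torus n L y" using assms by (simp add: to_torus_altdef)
qed

lemma torus_altdef: "torus n L = to_torus n L ` Rn n"
  by (auto simp: torus_def quotient_def to_torus_def)

lemma to_torus_in_torus [simp]: "x \<in> Rn n \<Longrightarrow> to_torus n L x \<in> torus n L"
  by (simp add: torus_altdef)

lemma Union_to_torus_image:
  assumes "A \<subseteq> Rn n"
  shows "\<Union>(to_torus n L ` A) = sat A"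
proof -
  have "\<Union>(to_torus n L ` A) = (\<Union>a\<in>A. {y \<in> Rn n. vdiff n y a \<in> L})"
    using assms to_torus_altdef by blast
  also have "\<dots> = sat A" using mem_sat[OF assms] by blast
  finally show ?thesis .
qed

text \<open>Links the two descriptions of a set of torus points: measurability is defined through
  unions of classes, \<open>distr\<close> works with preimages.\<close>

lemma to_torus_vimage:
  assumes "E \<subseteq> torus n L"
  shows "to_torus n L -` E \<inter> Rn n = \<Union>E"
proof (intro equalityI subsetI)
  fix x assume "x \<in> to_torus n L -` E \<inter> Rn n"
  then show "x \<in> \<Union>E" using mem_to_torus_self[of x] by blast
next
  fix x assume "x \<in> \<Union>E"
  then obtain e where e: "e \<in> E" "x \<in> e" by blast
  then obtain z where z: "z \<in> Rn n" "e = to_torus n L z" using assms by (auto simp: torus_altdef)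
  then have x: "x \<in> Rn n" "vdiff n x z \<in> L" using e by (auto simp: to_torus_altdef)
  then have "to_torus n L x = e" using z by (simp add: to_torus_eq_iff)
  with x e show "x \<in> to_torus n L -` E \<inter> Rn n" by simp
qed

lemma torus_borel_generator:
  "{A. A \<subseteq> torus n L \<and> \<Union>A \<in> sets (Rn_measure n)} \<subseteq> Pow (torus n L)"
  by auto

lemma space_torus_measure [simp]: "space (torus_measure n L) = torus n L"
  by (simp add: torus_measure_def torus_borel_def space_measure_of torus_borel_generator)

lemma sets_torus_measureI:
  "E \<subseteq> torus n L \<Longrightarrow> \<Union>E \<in> sets (Rn_measure n) \<Longrightarrow> E \<in> sets (torus_measure n L)"
  by (simp add: torus_measure_def torus_borel_def sets_measure_of torus_borel_generator)

lemma measurable_to_torus: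
  "to_torus n L \<in> restrict_space (Rn_measure n) fdom \<rightarrow>\<^sub>M torus_borel n L"
  unfolding torus_borel_def
proof (rule measurable_measure_of[OF torus_borel_generator])
  have space: "space (restrict_space (Rn_measure n) fdom) = fdom"
    using fdom_subset_Rn by (auto simp: space_restrict_space)
  show "to_torus n L \<in> space (restrict_space (Rn_measure n) fdom) \<rightarrow> torus n L"
    using fdom_subset_Rn by (auto simp: space)
  fix E assume E: "E \<in> {A. A \<subseteq> torus n L \<and> \<Union>A \<in> sets (Rn_measure n)}"
  have "to_torus n L -` E \<inter> fdom = fdom \<inter> \<Union>E"
    using to_torus_vimage[of E] E fdom_subset_Rn by blast
  then show "to_torus n L -` E \<inter> space (restrict_space (Rn_measure n) fdom)
      \<in> sets (restrict_space (Rn_measure n) fdom)"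
    using E by (auto simp: space sets_restrict_space)
qed

lemma emeasure_torus_measure:
  assumes E: "E \<subseteq> torus n L" "\<Union>E \<in> sets (Rn_measure n)"
  shows "emeasure (torus_measure n L) E = emeasure (Rn_measure n) (fdom \<inter> \<Union>E)"
proof -
  have "E \<in> sets (torus_borel n L)"
    using sets_torus_measureI[OF E] by (simp add: torus_measure_def)
  then have "emeasure (torus_measure n L) E
      = emeasure (restrict_space (Rn_measure n) fdom) (to_torus n L -` E \<inter> fdom)"
    unfolding torus_measure_def fdom_def[symmetric]
    using fdom_subset_Rn
    by (subst emeasure_distr[OF measurable_to_torus]) (auto simp: space_restrict_space Int_absorb2)
  also have "to_torus n L -` E \<inter> fdom = fdom \<inter> \<Union>E"
    using to_torus_vimage[OF E(1)] fdom_subset_Rn by blast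
  also have "emeasure (restrict_space (Rn_measure n) fdom) (fdom \<inter> \<Union>E)
      = emeasure (Rn_measure n) (fdom \<inter> \<Union>E)"
    by (rule emeasure_restrict_space) (auto simp: Int_absorb2 fdom_subset_Rn)
  finally show ?thesis .
qed

lemma sets_to_torus_image:
  assumes "A \<in> sets (Rn_measure n)"
  shows "to_torus n L ` A \<in> sets (torus_measure n L)"
  using assms sets_Rn_subset[OF assms]
  by (intro sets_torus_measureI) (auto simp: Union_to_torus_image)

lemma emeasure_to_torus_image:
  assumes "A \<in> sets (Rn_measure n)" "inj_mod A"
  shows "emeasure (torus_measure n L) (to_torus n L ` A) = emeasure (Rn_measure n) A"
  using assms sets_Rn_subset[OF assms(1)]
  by (subst emeasure_torus_measure) (auto simp: Union_to_torus_image emeasure_fdom_Int_sat)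

section \<open>Cubes in the torus and their overlap\<close>

text \<open>A ball of the sup norm. Radius 1/2 gives the copies of C that decide coverage, radius 1
  the copies of \<open>2C\<close>, and radius 1/(2n) the small cubes that bound |P|.\<close>

definition disc :: "real \<Rightarrow> (nat \<Rightarrow> real) \<Rightarrow> (nat \<Rightarrow> real) set set" where
  "disc r x = to_torus n L ` box_at n r x"

lemma sets_disc [measurable]: "disc r x \<in> sets (torus_measure n L)"
  unfolding disc_def by (rule sets_to_torus_image) simp

lemma emeasure_disc:
  assumes "0 \<le> r" "r \<le> 1"
  shows "emeasure (torus_measure n L) (disc r x) = ennreal ((2 * r) ^ n)"
  unfolding disc_def using assms
  by (subst emeasure_to_torus_image) (auto simp: emeasure_box_at inj_mod_box_at)

text \<open>
  As \<open>2C\<close> packs, at most one translate of the second cube meets the first, so the intersection in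
  the torus is that of two cubes in space.
\<close>

lemma emeasure_disc_Int_le:
  assumes x: "x \<in> Rn n" and y: "y \<in> Rn n"
    and far: "\<And>z. z \<in> Rn n \<Longrightarrow> vdiff n z y \<in> L \<Longrightarrow> s \<le> (\<Sum>i<n. \<bar>z i - x i\<bar>)"
  shows "emeasure (torus_measure n L) (disc (1/2) x \<inter> disc (1/2) y) \<le> ennreal (exp (- s))"
proof -
  let ?M = "Rn_measure n"
  \<comment> \<open>Lifts the overlap to space: the points of the first cube that are congruent to a
    point of the second. Lying inside one cube, \<open>A\<close> has the same volume in the
    torus.\<close>
  define A where "A = box_at n (1/2) x \<inter> sat (box_at n (1/2) y)"
  have A: "A \<in> sets ?M" unfolding A_def by (intro sets.Int sets_sat) auto
  have inj: "inj_mod A" unfolding A_def by (rule inj_mod_subset[OF inj_mod_box_at[of "1/2" x]]) auto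
  have "disc (1/2) x \<inter> disc (1/2) y = to_torus n L ` A"
  proof (intro equalityI subsetI)
    fix p assume "p \<in> disc (1/2) x \<inter> disc (1/2) y"
    then obtain a b where "a \<in> box_at n (1/2) x" "b \<in> box_at n (1/2) y"
      "p = to_torus n L a" "p = to_torus n L b" by (auto simp: disc_def)
    moreover from this have "a \<in> Rn n" "b \<in> Rn n" by (auto simp: mem_box_at)
    ultimately have "a \<in> A" using to_torus_eq_iff[of a b]
      by (auto simp: A_def mem_sat[OF box_at_subset_Rn])
    then show "p \<in> to_torus n L ` A" using \<open>p = to_torus n L a\<close> by blast
  next
    fix p assume "p \<in> to_torus n L ` A"
    then obtain a b where ab: "a \<in> box_at n (1/2) x" "b \<in> box_at n (1/2) y"
      "p = to_torus n L a" "vdiff n a b \<in> L" by (auto simp: A_def mem_sat[OF box_at_subset_Rn])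
    then have "a \<in> Rn n" "b \<in> Rn n" by (auto simp: mem_box_at)
    then have "p = to_torus n L b" using to_torus_eq_iff[of a b] ab by simp
    then show "p \<in> disc (1/2) x \<inter> disc (1/2) y" using ab by (auto simp: disc_def)
  qed
  then have "emeasure (torus_measure n L) (disc (1/2) x \<inter> disc (1/2) y) = emeasure ?M A"
    using emeasure_to_torus_image[OF A inj] by simp
  also have "\<dots> \<le> ennreal (exp (- s))"
  proof (cases "A = {}")
    case False
    then obtain a b where ab: "a \<in> box_at n (1/2) x" "b \<in> box_at n (1/2) y" "vdiff n a b \<in> L"
      by (auto simp: A_def mem_sat[OF box_at_subset_Rn])
    \<comment> \<open>The translate of \<open>y\<close> by the lattice vector a - b; its cube
      contains \<open>a\<close>.\<close>
    define z where "z = vadd n (vdiff n a b) y"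
    have z: "z \<in> Rn n" "vdiff n z y \<in> L" "\<And>i. i < n \<Longrightarrow> z i = a i - b i + y i"
      using ab(3) L_subset unfolding z_def by (auto simp: vdiff_vadd_cancel)
    have "A \<subseteq> (\<Pi>\<^sub>E i\<in>{..<n}. {max (x i) (z i) - 1/2..min (x i) (z i) + 1/2})"
    proof
      fix a' assume "a' \<in> A"
      then obtain b' where ab': "a' \<in> box_at n (1/2) x" "b' \<in> box_at n (1/2) y" "vdiff n a' b' \<in> L"
        by (auto simp: A_def mem_sat[OF box_at_subset_Rn])
      have bd: "\<bar>a i - x i\<bar> \<le> 1/2 \<and> \<bar>a' i - x i\<bar> \<le> 1/2 \<and> \<bar>b i - y i\<bar> \<le> 1/2 \<and> \<bar>b' i - y i\<bar> \<le> 1/2"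
        if "i < n" for i
        using that ab(1,2) ab'(1,2) unfolding mem_box_at by blast
      \<comment> \<open>Moving from \<open>a\<close> to \<open>a'\<close> and from \<open>b\<close>
        to \<open>b'\<close> changes each coordinate by at most 1, so the lattice vectors a - b and
        a' - b' are within 2 and coincide. Hence the one translate \<open>z\<close> serves all of
        \<open>A\<close>.\<close>
      have "\<bar>vdiff n (vdiff n a b) (vdiff n a' b') i\<bar> \<le> 2" if "i < n" for i
        using bd[OF that] that unfolding vdiff_apply[OF that] by linarith
      then have "vdiff n (vdiff n a b) (vdiff n a' b') i = 0" if "i < n" for i
        using L_separated[OF vdiff_L[OF ab(3) ab'(3)]] that by blast
      then have eq: "a' i = a i - b i + b' i" if "i < n" for i
        using that by (fastforce simp: algebra_simps)
      have "max (x i) (z i) - 1/2 \<le> a' i \<and> a' i \<le> min (x i) (z i) + 1/2" if "i < n" for i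
        using bd[OF that] eq[OF that] z(3)[OF that] by linarith
      moreover have "a' \<in> Rn n" using ab'(1) by (simp add: mem_box_at)
      ultimately show "a' \<in> (\<Pi>\<^sub>E i\<in>{..<n}. {max (x i) (z i) - 1/2..min (x i) (z i) + 1/2})"
        by (auto simp: Rn_def PiE_iff)
    qed
    then have "emeasure ?M A \<le> emeasure ?M (\<Pi>\<^sub>E i\<in>{..<n}. {max (x i) (z i) - 1/2..min (x i) (z i) + 1/2})"
      by (rule emeasure_mono) (rule sets_PiE_interval)
    also have "\<dots> = ennreal (\<Prod>i<n. max 0 (1 - \<bar>z i - x i\<bar>))"
      unfolding emeasure_PiE_interval by (intro arg_cong[of _ _ ennreal] prod.cong) auto
    \<comment> \<open>By 1 - t \<le> exp (-t) the product of side lengths is controlled by an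
      l1-distance, the norm whose balls are the cross-polytopes.\<close>
    also have "\<dots> \<le> ennreal (\<Prod>i<n. exp (- \<bar>z i - x i\<bar>))"
    proof (intro ennreal_leI prod_mono conjI)
      fix i show "max 0 (1 - \<bar>z i - x i\<bar>) \<le> exp (- \<bar>z i - x i\<bar>)"
        using exp_ge_add_one_self[of "- \<bar>z i - x i\<bar>"] by simp
    qed auto
    also have "(\<Prod>i<n. exp (- \<bar>z i - x i\<bar>)) = exp (- (\<Sum>i<n. \<bar>z i - x i\<bar>))"
      by (simp add: exp_sum flip: sum_negf)
    also have "ennreal \<dots> \<le> ennreal (exp (- s))"
      using far[OF z(1,2)] by (intro ennreal_leI) simp
    finally show ?thesis .
  qed simp
  finally show ?thesis .
qed

section \<open>Coverage as a hitting event, and distances in the packing\<close>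

text \<open>Because C = -C, x lies in C + y exactly when y lies in C + x, modulo \<open>L\<close>.
  Being uncovered thus becomes a void event for one fixed cube.\<close>

lemma mem_torus_sum_cube:
  assumes x: "x \<in> Rn n" and Y: "Y \<subseteq> torus n L"
  shows "to_torus n L x \<in> torus_sum n L (cube n) Y \<longleftrightarrow> Y \<inter> disc (1/2) x \<noteq> {}"
proof
  assume "to_torus n L x \<in> torus_sum n L (cube n) Y"
  then obtain a y where ay: "a \<in> cube n" "y \<in> \<Union>Y" "to_torus n L x = to_torus n L (vadd n a y)"
    unfolding torus_sum_def by blast
  then have y: "y \<in> Rn n" "to_torus n L y \<in> Y"
    using to_torus_vimage[OF Y] by auto
  have "vdiff n x (vadd n a y) \<in> L" using ay(3) x by (simp add: to_torus_eq_iff)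
  moreover have "vdiff n x (vadd n a y) = vdiff n (vdiff n x a) y"
    by (rule Rn_eqI[of _ n]) auto
  ultimately have "to_torus n L (vdiff n x a) = to_torus n L y"
    using y by (simp add: to_torus_eq_iff)
  moreover have "vdiff n x a \<in> box_at n (1/2) x"
    using ay(1) by (force simp: mem_box_at cube_def abs_le_iff PiE_iff)
  ultimately show "Y \<inter> disc (1/2) x \<noteq> {}" using y(2) unfolding disc_def by (metis IntI empty_iff imageI)
next
  assume "Y \<inter> disc (1/2) x \<noteq> {}"
  then obtain y where y: "y \<in> box_at n (1/2) x" "to_torus n L y \<in> Y" by (auto simp: disc_def)
  then have yRn: "y \<in> Rn n" by (simp add: mem_box_at)
  have "- 1 / 2 \<le> x i - y i \<and> x i - y i \<le> 1 / 2" if "i < n" for i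
  proof -
    have "\<bar>y i - x i\<bar> \<le> 1 / 2" using y(1) that by (simp add: mem_box_at)
    then show ?thesis by linarith
  qed
  then have "vdiff n x y \<in> cube n"
    by (auto simp: cube_def vdiff_def)
  moreover have "y \<in> \<Union>Y" using y(2) mem_to_torus_self[OF yRn] by blast
  moreover have "vadd n (vdiff n x y) y = x" using x by simp
  ultimately show "to_torus n L x \<in> torus_sum n L (cube n) Y"
    unfolding torus_sum_def by (metis (mono_tags, lifting) image_eqI mem_Collect_eq)
qed

text \<open>Otherwise the midpoint of \<open>x\<close> and \<open>z\<close> would lie in both
  translated cross-polytopes. Since \<open>x\<close> and \<open>z\<close> are arbitrary
  representatives, the bound holds for every lift of the two points.\<close>

lemma torus_packing_far:
  assumes P: "torus_packing n L (cross_polytope n) P"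
    and x: "x \<in> Rn n" "to_torus n L x \<in> P" and z: "z \<in> Rn n" "to_torus n L z \<in> P"
    and ne: "to_torus n L x \<noteq> to_torus n L z"
  shows "4 * ln (real n) < (\<Sum>i<n. \<bar>z i - x i\<bar>)"
proof (rule ccontr)
  assume "\<not> ?thesis"
  then have le: "(\<Sum>i<n. \<bar>z i - x i\<bar>) \<le> 4 * ln (real n)" by simp
  define a where "a = vscale n (1/2) (vdiff n z x)"
  have "(\<Sum>i<n. \<bar>a i\<bar>) = (\<Sum>i<n. \<bar>z i - x i\<bar>) / 2"
    unfolding a_def sum_divide_distrib by (intro sum.cong) auto
  moreover have "(\<Sum>i<n. \<bar>vscale n (-1) a i\<bar>) = (\<Sum>i<n. \<bar>a i\<bar>)" by simp
  moreover have "a \<in> Rn n" by (simp add: a_def)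
  ultimately have a: "a \<in> cross_polytope n" "vscale n (-1) a \<in> cross_polytope n"
    using le unfolding cross_polytope_def by auto
  have eq: "vadd n a x = vadd n (vscale n (-1) a) z"
    by (rule Rn_eqI[of _ n]) (auto simp: a_def field_simps)
  have "to_torus n L (vadd n a x) \<in> torus_sum n L (cross_polytope n) {to_torus n L x}"
    using a(1) mem_to_torus_self[OF x(1)] unfolding torus_sum_def by blast
  moreover have "to_torus n L (vadd n a x) \<in> torus_sum n L (cross_polytope n) {to_torus n L z}"
    unfolding eq using a(2) mem_to_torus_self[OF z(1)] unfolding torus_sum_def by blast
  moreover have "disjnt (torus_sum n L (cross_polytope n) {to_torus n L x})
      (torus_sum n L (cross_polytope n) {to_torus n L z})"
    using P x z ne unfolding torus_packing_def pairwise_def by blast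
  ultimately show False unfolding disjnt_def by blast
qed

end

section \<open>Packing lattices of \<open>2C\<close> are packing groups\<close>

lemma packing_group_if_packing_lattice:
  assumes "packing_lattice n (vscale n 2 ` cube n) L"
  shows "packing_group n L"
proof -
  define pt where "pt b z = (\<lambda>j\<in>{..<n}. \<Sum>i<n. of_int (z i) * b i j)"
    for b :: "nat \<Rightarrow> nat \<Rightarrow> real" and z :: "nat \<Rightarrow> int"
  obtain b where L: "L = range (pt b)"
    using assms unfolding packing_lattice_def is_lattice_def pt_def by blast
  have pt_Rn: "pt b z \<in> Rn n" for z by (simp add: pt_def Rn_def)
  then have sub: "L \<subseteq> Rn n" unfolding L by blast
  have vdiff_pt: "vdiff n (pt b z) (pt b z') = pt b (\<lambda>i. z i - z' i)" for z z'
  proof (rule Rn_eqI[OF vdiff_in_Rn pt_Rn])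
    fix j assume "j < n"
    then show "vdiff n (pt b z) (pt b z') j = pt b (\<lambda>i. z i - z' i) j"
      by (simp add: pt_def left_diff_distrib sum_subtractf)
  qed
  have zero: "pt b (\<lambda>_. 0) \<in> L" unfolding L by simp
  show ?thesis
  proof
    show "L \<subseteq> Rn n" "L \<noteq> {}" using sub zero by auto
    \<comment> \<open>There are uncountably many coefficient functions on all of \<open>nat\<close>;
      only their first \<open>n\<close> values matter.\<close>
    have "L \<subseteq> pt b ` (\<Pi>\<^sub>E i\<in>{..<n}. UNIV)"
    proof
      fix l assume "l \<in> L"
      then obtain z where "l = pt b z" by (auto simp: L)
      then have "l = pt b (restrict z {..<n})" by (auto simp: pt_def intro!: restrict_ext sum.cong)
      then show "l \<in> pt b ` (\<Pi>\<^sub>E i\<in>{..<n}. UNIV)" by auto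
    qed
    moreover have "countable (\<Pi>\<^sub>E i\<in>{..<n}. UNIV :: int set)" by (intro countable_PiE) auto
    ultimately show "countable L" by (meson countable_image countable_subset)
  next
    fix x y assume "x \<in> L" "y \<in> L"
    then show "vdiff n x y \<in> L" using vdiff_pt unfolding L by auto
  next
    fix l i assume l: "l \<in> L" "\<And>i. i < n \<Longrightarrow> \<bar>l i\<bar> \<le> 2" and i: "i < n"
    show "l i = 0"
    proof (rule ccontr)
      assume "l i \<noteq> 0"
      let ?o = "pt b (\<lambda>_. 0)" and ?K = "vscale n 2 ` cube n"
      have oi: "?o j = 0" if "j < n" for j using that by (simp add: pt_def)
      have "l \<noteq> ?o" using \<open>l i \<noteq> 0\<close> oi[OF i] by auto
      then have "disjnt (vadd n ?o ` ?K) (vadd n l ` ?K)"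
        using assms l(1) zero unfolding packing_lattice_def pairwise_def by metis
      \<comment> \<open>The common point is l/2, reached as 2(l/4) from the origin and as l +
        2(-l/4) from \<open>l\<close>.\<close>
      moreover have "vscale n (1/4) l \<in> cube n" "vscale n (-1/4) l \<in> cube n"
        using l(2) by (force simp: cube_def vscale_def abs_le_iff)+
      moreover have "vadd n ?o (vscale n 2 (vscale n (1/4) l)) = vadd n l (vscale n 2 (vscale n (-1/4) l))"
        by (rule Rn_eqI[of _ n]) (auto simp: oi)
      ultimately show False unfolding disjnt_iff by (metis imageI)
    qed
  qed
qed

section \<open>Probabilistic tools: second moments and void probabilities\<close>

text \<open>Let \<open>f\<close> count the events that occur. If none does, \<open>f\<close> is 0
  and deviates from its mean by the whole mean, which Chebyshev's inequality bounds; the double sum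
  is the second moment of \<open>f\<close>.\<close>

lemma (in prob_space) second_moment_no_event:
  fixes A :: "'i \<Rightarrow> 'a set"
  assumes fin: "finite I" and A: "\<And>i. i \<in> I \<Longrightarrow> A i \<in> events"
    and pos: "(\<Sum>i\<in>I. prob (A i)) > 0"
  shows "prob (space M - (\<Union>i\<in>I. A i))
    \<le> (\<Sum>i\<in>I. \<Sum>j\<in>I. prob (A i \<inter> A j)) / (\<Sum>i\<in>I. prob (A i))\<^sup>2 - 1"
proof -
  define m where "m = (\<Sum>i\<in>I. prob (A i))"
  define f :: "'a \<Rightarrow> real" where "f \<omega> = (\<Sum>i\<in>I. indicator (A i) \<omega>)" for \<omega>
  have int: "integrable M (indicator B :: 'a \<Rightarrow> real)" if "B \<in> events" for B
    using that by (simp add: emeasure_eq_measure)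
  have f_int: "integrable M f" unfolding f_def using A int by (intro Bochner_Integration.integrable_sum) auto
  have f2: "(f \<omega>)\<^sup>2 = (\<Sum>i\<in>I. \<Sum>j\<in>I. indicator (A i \<inter> A j) \<omega>)" for \<omega>
    by (simp add: f_def power2_eq_square sum_product indicator_inter_arith)
  have f2_int: "integrable M (\<lambda>\<omega>. (f \<omega>)\<^sup>2)"
    unfolding f2 using A int by (intro Bochner_Integration.integrable_sum) auto
  have Ef: "expectation f = m"
    unfolding f_def m_def using A int
    by (subst Bochner_Integration.integral_sum) (auto intro!: sum.cong simp: Int_absorb2 sets.sets_into_space)
  have "expectation (\<lambda>\<omega>. (f \<omega>)\<^sup>2) = (\<Sum>i\<in>I. \<Sum>j\<in>I. expectation (indicator (A i \<inter> A j)))"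
    unfolding f2 using A int
    by (subst Bochner_Integration.integral_sum)
      (auto intro!: sum.cong Bochner_Integration.integrable_sum Bochner_Integration.integral_sum)
  also have "\<dots> = (\<Sum>i\<in>I. \<Sum>j\<in>I. prob (A i \<inter> A j))"
    using A by (auto intro!: sum.cong arg_cong[of _ _ prob] dest: sets.sets_into_space)
  finally have Ef2: "expectation (\<lambda>\<omega>. (f \<omega>)\<^sup>2) = (\<Sum>i\<in>I. \<Sum>j\<in>I. prob (A i \<inter> A j))" .
  have [measurable]: "random_variable borel f" using f_int by auto
  have "prob (space M - (\<Union>i\<in>I. A i)) \<le> prob {\<omega> \<in> space M. m \<le> \<bar>f \<omega> - expectation f\<bar>}"
  proof (intro finite_measure_mono subsetI)
    fix \<omega> assume "\<omega> \<in> space M - (\<Union>i\<in>I. A i)"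
    moreover from this have "f \<omega> = 0" by (simp add: f_def)
    ultimately show "\<omega> \<in> {\<omega> \<in> space M. m \<le> \<bar>f \<omega> - expectation f\<bar>}"
      by (simp add: Ef)
  qed measurable
  also have "\<dots> \<le> variance f / m\<^sup>2"
    using pos by (intro Chebyshev_inequality f2_int) (auto simp: m_def)
  also have "\<dots> = (\<Sum>i\<in>I. \<Sum>j\<in>I. prob (A i \<inter> A j)) / m\<^sup>2 - 1"
    using pos unfolding variance_eq[OF f_int f2_int] unfolding Ef Ef2
    by (simp add: m_def diff_divide_distrib)
  finally show ?thesis by (simp add: m_def)
qed

text \<open>The case k = 0 of the counting law, where the power factor is 1 even if the mean is
  0.\<close>

lemma poisson_process_void:
  fixes X :: "'w \<Rightarrow> 'a set"
  assumes "poisson_process M T \<rho> X" "S \<in> sets T"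
  shows "{\<omega> \<in> space M. X \<omega> \<inter> S = {}} \<in> sets M"
    and "measure M {\<omega> \<in> space M. X \<omega> \<inter> S = {}} = exp (- (\<rho> * measure T S))"
proof -
  have zero: "num_points A = 0 \<longleftrightarrow> A = {}" for A :: "'a set"
    by (auto simp: num_points_def enat_0_iff)
  have "(\<lambda>\<omega>. num_points (X \<omega> \<inter> S)) \<in> measurable M (count_space UNIV)"
    using assms by (auto simp: poisson_process_def)
  from measurable_sets[OF this, of "{0}"]
  have "(\<lambda>\<omega>. num_points (X \<omega> \<inter> S)) -` {0} \<inter> space M \<in> sets M" by simp
  moreover have "(\<lambda>\<omega>. num_points (X \<omega> \<inter> S)) -` {0} \<inter> space M = {\<omega> \<in> space M. X \<omega> \<inter> S = {}}"
    by (simp add: zero vimage_def Int_def conj_commute)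
  ultimately show "{\<omega> \<in> space M. X \<omega> \<inter> S = {}} \<in> sets M" by simp
  have "measure M {\<omega> \<in> space M. num_points (X \<omega> \<inter> S) = enat 0}
      = (\<rho> * measure T S) ^ 0 / fact 0 * exp (- (\<rho> * measure T S))"
    using assms unfolding poisson_process_def by blast
  then show "measure M {\<omega> \<in> space M. X \<omega> \<inter> S = {}} = exp (- (\<rho> * measure T S))"
    by (simp add: zero flip: zero_enat_def)
qed

section \<open>The covering probability in a fixed dimension\<close>

context packing_group
begin

text \<open>If two such cubes of side 1/n met, some lift of one centre would be within l1-distance n
  * (1/n) = 1 of the other centre, but lifts are more than \<open>4 * ln n\<close> apart.\<close>

lemma torus_packing_disjoint_disc:
  assumes P: "torus_packing n L (cross_polytope n) P"
    and x: "x \<in> Rn n" "to_torus n L x \<in> P" and y: "y \<in> Rn n" "to_torus n L y \<in> P"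
    and ne: "to_torus n L x \<noteq> to_torus n L y" and n: "n \<ge> 3"
  shows "disc (1 / (2 * real n)) x \<inter> disc (1 / (2 * real n)) y = {}"
proof (rule ccontr)
  let ?r = "1 / (2 * real n)"
  assume "disc ?r x \<inter> disc ?r y \<noteq> {}"
  then obtain a b where ab: "a \<in> box_at n ?r x" "b \<in> box_at n ?r y" "to_torus n L a = to_torus n L b"
    unfolding disc_def by blast
  then have d: "vdiff n a b \<in> L" by (auto simp: to_torus_eq_iff mem_box_at)
  define z where "z = vadd n (vdiff n a b) y"
  have z: "z \<in> Rn n" "vdiff n z y \<in> L" using d by (auto simp: z_def)
  then have "to_torus n L z = to_torus n L y" using y by (simp add: to_torus_eq_iff)
  then have "4 * ln (real n) < (\<Sum>i<n. \<bar>z i - x i\<bar>)"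
    using torus_packing_far[OF P x z(1)] y ne by simp
  also have "\<dots> \<le> (\<Sum>i<n. 1 / real n)"
  proof (intro sum_mono)
    fix i assume i: "i \<in> {..<n}"
    then have "\<bar>a i - x i\<bar> \<le> ?r" "\<bar>b i - y i\<bar> \<le> ?r" using ab by (auto simp: mem_box_at)
    then have "\<bar>z i - x i\<bar> \<le> ?r + ?r" using i unfolding z_def by simp
    then show "\<bar>z i - x i\<bar> \<le> 1 / real n" using n by (simp add: field_simps)
  qed
  also have "\<dots> = 1" using n by simp
  finally have "ln (real n) < 1 / 4" by simp
  \<comment> \<open>The origin of the condition n \<ge> 3: exp 1 \<le> 3.\<close>
  moreover have "1 \<le> ln (real n)"
    using n exp_le by (subst ln_ge_iff) auto
  ultimately show False by simp
qed

text \<open>The first term bounds 1/V, the contribution of the diagonal pairs; the second bounds the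
  excess of distinct pairs over independence.\<close>

lemma covering_prob_le:
  assumes n: "n \<ge> 3"
    and P: "torus_packing n L (cross_polytope n) P"
    and large: "real (card P) > torus_vol n L"
    and X: "poisson_process M (torus_measure n L) (ln (real (card P)) - ln (torus_vol n L)) X"
  shows "measure M {\<omega> \<in> space M. P \<subseteq> torus_sum n L (cube n) (X \<omega>)}
    \<le> (1 / 2) ^ n + (exp (real n * ln (real n) / real n ^ 4) - 1)"
proof -
  define T where "T = torus_measure n L"
  define V where "V = torus_vol n L"
  define N where "N = real (card P)"
  define \<rho> where "\<rho> = ln N - ln V"
  define K where "K = exp (real n * ln (real n) / real n ^ 4)"
  have V_eq: "V = measure T (space T)" by (simp add: V_def torus_vol_def T_def)
  have X': "poisson_process M T \<rho> X" using X by (simp add: T_def \<rho>_def N_def V_def)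
  interpret prob_space M using X' by (simp add: poisson_process_def)
  note void = poisson_process_void[OF X']
  have V0: "V \<ge> 0" by (simp add: V_eq)
  have N0: "N > 0" using V0 large by (simp add: N_def V_def)
  \<comment> \<open>\<open>card\<close> is 0 on infinite sets, so a positive cardinality also gives
    finiteness.\<close>
  then have finP: "finite P" and neP: "P \<noteq> {}" by (auto simp: N_def card_gt_0_iff)
  have X_sub: "X \<omega> \<subseteq> torus n L" if "\<omega> \<in> space M" for \<omega>
    using X that by (simp add: poisson_process_def)
  have "\<exists>x. x \<in> Rn n \<and> p = to_torus n L x" if "p \<in> P" for p
    using P that by (auto simp: torus_packing_def torus_altdef)
  then obtain x where x: "\<And>p. p \<in> P \<Longrightarrow> x p \<in> Rn n \<and> p = to_torus n L (x p)" by metis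
  define U where "U p = {\<omega> \<in> space M. X \<omega> \<inter> disc (1/2) (x p) = {}}" for p
  have disc_T: "disc r y \<in> sets T" for r y by (simp add: T_def)
  have U: "U p \<in> events" for p unfolding U_def by (rule void(1)[OF disc_T])
  have event_eq: "{\<omega> \<in> space M. P \<subseteq> torus_sum n L (cube n) (X \<omega>)} = space M - (\<Union>p\<in>P. U p)"
  proof -
    have "p \<in> torus_sum n L (cube n) (X \<omega>) \<longleftrightarrow> \<omega> \<notin> U p" if "\<omega> \<in> space M" "p \<in> P" for \<omega> p
      using mem_torus_sum_cube[of "x p", OF _ X_sub[OF that(1)]] x[OF that(2)] that(1)
      by (auto simp: U_def)
    then show ?thesis by blast
  qed
  show ?thesis
  proof (cases "V = 0")
    case True
    txt \<open>
      This includes infinite covolume, where \<^term>\<open>measure\<close> is 0 and \<open>ln 0 = 0\<close>; then the process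
      has no points almost surely, so covolume finiteness need not be proved.
    \<close>
    have "prob {\<omega> \<in> space M. X \<omega> \<inter> space T = {}} = 1"
      using void(2)[of "space T"] True by (simp add: V_eq)
    then have "prob (space M - {\<omega> \<in> space M. X \<omega> \<inter> space T = {}}) = 0"
      using void(1)[of "space T"] by (subst prob_compl) auto
    moreover have "space M - (\<Union>p\<in>P. U p) \<subseteq> space M - {\<omega> \<in> space M. X \<omega> \<inter> space T = {}}"
      using neP sets.sets_into_space[OF disc_T] by (fastforce simp: U_def)
    ultimately have "prob (space M - (\<Union>p\<in>P. U p)) \<le> 0"
      using finite_measure_mono[of "space M - (\<Union>p\<in>P. U p)" "space M - {\<omega> \<in> space M. X \<omega> \<inter> space T = {}}"]
        void(1)[of "space T"] by auto
    moreover have "0 \<le> (1 / 2) ^ n + (exp (real n * ln (real n) / real n ^ 4) - 1)"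
      using n by (intro add_nonneg_nonneg) auto
    ultimately show ?thesis unfolding event_eq by linarith
  next
    case False
    then have V1: "V > 0" using V0 by simp
    \<comment> \<open>\<open>measure\<close> is 0 when the volume is infinite, so V \<noteq> 0
      already means finite volume.\<close>
    interpret T: finite_measure T
      using False by (intro finite_measureI) (auto simp: V_eq measure_def)
    have measure_disc: "measure T (disc r y) = (2 * r) ^ n" if "0 \<le> r" "r \<le> 1" for r y
      using emeasure_disc[OF that, of y] that by (simp add: measure_def T_def)
    \<comment> \<open>A copy of \<open>2C\<close> embeds in the torus; its centre is arbitrary,
      hence \<open>x undefined\<close>.\<close>
    have "V \<ge> 2 ^ n"
      using T.bounded_measure[of "disc 1 (x undefined)"] measure_disc[of 1 "x undefined"] by (simp add: V_eq)
    have N_le: "N \<le> V * real n ^ n"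
    proof -
      let ?r = "1 / (2 * real n)"
      have "disjoint_family_on (\<lambda>p. disc ?r (x p)) P"
        unfolding disjoint_family_on_def
        using torus_packing_disjoint_disc[OF P] n x by metis
      then have "(\<Sum>p\<in>P. measure T (disc ?r (x p))) = measure T (\<Union>p\<in>P. disc ?r (x p))"
        using finP disc_T by (subst T.finite_measure_finite_Union) auto
      also have "\<dots> \<le> V" unfolding V_eq by (rule T.bounded_measure)
      finally have "N * (1 / real n) ^ n \<le> V"
        using n by (simp add: measure_disc N_def)
      then show ?thesis using n by (simp add: field_simps)
    qed
    have "ln N \<le> ln (V * real n ^ n)" using N_le N0 by simp
    also have "\<dots> = ln V + real n * ln (real n)" using V1 n by (simp add: ln_mult ln_realpow)
    finally have \<rho>_le: "\<rho> \<le> real n * ln (real n)" by (simp add: \<rho>_def)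
    \<comment> \<open>The intensity is chosen for this: each of the N points is uncovered with
      probability V/N.\<close>
    have exp_\<rho>: "exp (- \<rho>) = V / N" using V1 N0 by (simp add: \<rho>_def exp_diff)
    have \<rho>0: "\<rho> \<ge> 0" using large V1 by (simp add: \<rho>_def N_def V_def)
    have prob_U: "prob (U p) = V / N" for p
      unfolding U_def void(2)[OF disc_T] by (simp add: measure_disc exp_\<rho>)
    have prob_UU: "prob (U p \<inter> U q) \<le> (V / N)\<^sup>2 * K" if pq: "p \<in> P" "q \<in> P" "p \<noteq> q" for p q
    proof -
      let ?A = "disc (1/2) (x p)" and ?B = "disc (1/2) (x q)"
      have "emeasure T (?A \<inter> ?B) \<le> ennreal (exp (- (4 * ln (real n))))"
        unfolding T_def
      proof (rule emeasure_disc_Int_le)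
        fix z assume z: "z \<in> Rn n" "vdiff n z (x q) \<in> L"
        then have "to_torus n L z = q" using x[OF pq(2)] to_torus_eq_iff by metis
        then show "4 * ln (real n) \<le> (\<Sum>i<n. \<bar>z i - x p i\<bar>)"
          using torus_packing_far[OF P, of "x p" z] x[OF pq(1)] z(1) pq by fastforce
      qed (use x pq in auto)
      then have "measure T (?A \<inter> ?B) \<le> exp (- (4 * ln (real n)))"
        by (simp add: T.emeasure_eq_measure)
      also have "exp (- (4 * ln (real n))) = 1 / real n ^ 4"
        using n exp_of_nat_mult[of 4 "ln (real n)"] by (simp add: exp_minus field_simps)
      finally have int: "measure T (?A \<inter> ?B) \<le> 1 / real n ^ 4" .
      \<comment> \<open>Inclusion-exclusion with two cubes of volume 1.\<close>
      have "measure T (?A \<union> ?B) = 2 - measure T (?A \<inter> ?B)"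
        using measure_Un3[of ?A T ?B] disc_T by (simp add: T.fmeasurable_eq_sets measure_disc)
      then have un: "measure T (?A \<union> ?B) \<ge> 2 - 1 / real n ^ 4" using int by simp
      \<comment> \<open>Both points are uncovered exactly when the union of their cubes is void, so
        the joint probability is again a void probability.\<close>
      have "U p \<inter> U q = {\<omega> \<in> space M. X \<omega> \<inter> (?A \<union> ?B) = {}}" by (auto simp: U_def)
      then have "prob (U p \<inter> U q) = exp (- (\<rho> * measure T (?A \<union> ?B)))"
        using void(2)[of "?A \<union> ?B"] disc_T by simp
      also have "\<dots> \<le> exp (- \<rho> + - \<rho> + real n * ln (real n) / real n ^ 4)"
      proof -
        have "\<rho> * (2 - 1 / real n ^ 4) \<le> \<rho> * measure T (?A \<union> ?B)"
          using un \<rho>0 by (rule mult_left_mono)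
        moreover have "\<rho> / real n ^ 4 \<le> real n * ln (real n) / real n ^ 4"
          using \<rho>_le by (rule divide_right_mono) simp
        ultimately show ?thesis by (simp add: algebra_simps)
      qed
      also have "\<dots> = (V / N)\<^sup>2 * K" unfolding exp_add exp_\<rho> K_def by (simp add: power2_eq_square)
      finally show ?thesis .
    qed
    have sum_U: "(\<Sum>p\<in>P. prob (U p)) = V" using N0 by (simp add: prob_U N_def)
    \<comment> \<open>The off-diagonal bound is nonnegative, so adding it on the diagonal too keeps
      the inequality and makes the double sum explicit.\<close>
    have "(\<Sum>p\<in>P. \<Sum>q\<in>P. prob (U p \<inter> U q))
        \<le> (\<Sum>p\<in>P. \<Sum>q\<in>P. (if p = q then V / N else 0) + (V / N)\<^sup>2 * K)"
    proof (intro sum_mono)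
      fix p q assume "p \<in> P" "q \<in> P"
      then show "prob (U p \<inter> U q) \<le> (if p = q then V / N else 0) + (V / N)\<^sup>2 * K"
        using prob_UU[of p q] by (cases "p = q") (auto simp: prob_U K_def)
    qed
    also have "\<dots> = N * (V / N + N * ((V / N)\<^sup>2 * K))"
      using finP by (simp add: sum.distrib N_def)
    also have "\<dots> = V + V\<^sup>2 * K" using N0 by (simp add: field_simps power2_eq_square)
    finally have second: "(\<Sum>p\<in>P. \<Sum>q\<in>P. prob (U p \<inter> U q)) \<le> V + V\<^sup>2 * K" .
    have "prob (space M - (\<Union>p\<in>P. U p)) \<le> (\<Sum>p\<in>P. \<Sum>q\<in>P. prob (U p \<inter> U q)) / V\<^sup>2 - 1"
      using second_moment_no_event[of P U, OF finP U] V1 unfolding sum_U by simp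
    also have "\<dots> \<le> (V + V\<^sup>2 * K) / V\<^sup>2 - 1"
      using second by (intro diff_right_mono divide_right_mono) auto
    also have "\<dots> = 1 / V + (K - 1)" using V1 by (simp add: field_simps power2_eq_square)
    also have "1 / V \<le> (1 / 2) ^ n"
      using \<open>V \<ge> 2 ^ n\<close> V1 by (simp add: field_simps power_one_over)
    finally show ?thesis unfolding event_eq K_def by simp
  qed
qed

end

section \<open>Passage to the limit\<close>

theorem theorem3p5:
  fixes \<Lambda> :: "nat \<Rightarrow> (nat \<Rightarrow> real) set"
    and P :: "nat \<Rightarrow> (nat \<Rightarrow> real) set set"
    and M :: "nat \<Rightarrow> 'w measure"
    and X :: "nat \<Rightarrow> 'w \<Rightarrow> (nat \<Rightarrow> real) set set"
    and n0 :: nat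
  assumes lattice: "\<And>n. n \<ge> n0 \<Longrightarrow> packing_lattice n (vscale n 2 ` cube n) (\<Lambda> n)"
    and packing: "\<And>n. n \<ge> n0 \<Longrightarrow> torus_packing n (\<Lambda> n) (cross_polytope n) (P n)"
    and large: "\<And>n. n \<ge> n0 \<Longrightarrow> real (card (P n)) > torus_vol n (\<Lambda> n)"
    and poisson: "\<And>n. n \<ge> n0 \<Longrightarrow>
      poisson_process (M n) (torus_measure n (\<Lambda> n))
        (ln (real (card (P n))) - ln (torus_vol n (\<Lambda> n))) (X n)"
  shows "(\<lambda>n. measure (M n) {\<omega> \<in> space (M n). P n \<subseteq> torus_sum n (\<Lambda> n) (cube n) (X n \<omega>)})
           \<longlonglongrightarrow> 0"
proof (rule tendsto_sandwich[where f = "\<lambda>_. 0"])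
  show "\<forall>\<^sub>F n in sequentially.
      measure (M n) {\<omega> \<in> space (M n). P n \<subseteq> torus_sum n (\<Lambda> n) (cube n) (X n \<omega>)}
      \<le> (1 / 2) ^ n + (exp (real n * ln (real n) / real n ^ 4) - 1)"
    \<comment> \<open>The hypotheses hold from \<open>n0\<close> on, the explicit bound from 3
      on.\<close>
    using eventually_ge_at_top[of "max n0 3"]
  proof eventually_elim
    case (elim n)
    then interpret packing_group n "\<Lambda> n"
      by (intro packing_group_if_packing_lattice lattice) simp
    show ?case
      using elim by (intro covering_prob_le packing large poisson) simp_all
  qed
  show "(\<lambda>n. (1 / 2) ^ n + (exp (real n * ln (real n) / real n ^ 4) - 1)) \<longlonglongrightarrow> 0"
    by real_asymp
qed auto

end
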